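(* For any $(n-1)$-dimensional simplicial complex $K$ on the vertex set $[m]$, $K\ne2^{[m]}$, one has $$\chi(\mathcal Z_K,t)=(1-t^2)^{m-n}\bigl(h_0+h_1t^2+\cdots+h_nt^{2n}\bigr),$$ where $(h_0,h_1,\ldots,h_n)$ is the $h$-vector of $K$.
   Context: $[m]=\{1,\ldots,m\}$; $K\subset2^{[m]}$ is closed under subsets, contains $\varnothing$ and all $\{i\}$, $i\in[m]$. $f_i$ is the number of $i$-simplices of $K$, $f_{-1}=1$, and the $h$-vector is defined by $h_0t^n+\cdots+h_{n-1}t+h_n=(t-1)^n+f_0(t-1)^{n-1}+\cdots+f_{n-1}$. Let $(D^2)^m=\{z\in\mathbb C^m:|z_i|\le1\}$ and $\mathcal Z_K=\bigcup_{J\in K}\{z\in(D^2)^m:|z_j|=1\text{ for }j\notin J\}$ (the moment-angle complex). Give $D^2$ the cell decomposition with $0$-cell $1$ (the point $1\in S^1$), $1$-cell $T=S^1\setminus\{1\}$, $2$-cell $D$ (the open disk). The product decomposition of $(D^2)^m$ has cells $D_IT_P$ ($I\cap P=\varnothing$; $i$-th factor $D$ for $i\in I$, $T$ for $i\in P$, $1$ otherwise), and $\mathcal Z_K$ is the subcomplex of cells $D_IT_P$ with $I\in K$. Let $[\mathcal C_{*}(\mathcal Z_K),\partial_c]$ be the cellular chain complex over a field $\mathbf k$ of characteristic zero, bigraded by $\mathrm{bideg}(D_i)=(0,2)$, $\mathrm{bideg}(T_i)=(-1,2)$, $\mathrm{bideg}(1_i)=(0,0)$ (additively on products), so that $\partial_c$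 adds $(-1,0)$ to bidegree. Let $b_{-q,2p}(\mathcal Z_K)=\dim H_{-q,2p}[\mathcal C_{*}(\mathcal Z_K),\partial_c]$, $$\chi_p(\mathcal Z_K)=\sum_{q=0}^m(-1)^q\dim\mathcal C_{-q,2p}(\mathcal Z_K)=\sum_{q=0}^m(-1)^qb_{-q,2p}(\mathcal Z_K),\qquad \chi(\mathcal Z_K,t)=\sum_{p=0}^m\chi_p(\mathcal Z_K)t^{2p}.$$ *)

theory Defs
  imports
    Complex_Main
    "HOL-Library.FuncSet"
    "HOL-Library.Function_Algebras"
    "HOL-Library.Product_Plus"
    "HOL-Computational_Algebra.Polynomial"
begin

subsection \<open>Simplicial complexes on the vertex set [m] and h-vectors\<close>

definition simplicial_complex_on :: "nat \<Rightarrow> nat set set \<Rightarrow> bool" where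
  "simplicial_complex_on m K \<longleftrightarrow>
     K \<subseteq> Pow {1..m} \<and> {} \<in> K \<and> (\<forall>i\<in>{1..m}. {i} \<in> K) \<and>
     (\<forall>J\<in>K. \<forall>I. I \<subseteq> J \<longrightarrow> I \<in> K)"

definition complex_dim :: "nat set set \<Rightarrow> int" where
  "complex_dim K = Max ((\<lambda>J. int (card J) - 1) ` K)"

text \<open>The index is an integer, so that \<open>face_number K (- 1) = 1\<close> counts the empty simplex.\<close>

definition face_number :: "nat set set \<Rightarrow> int \<Rightarrow> nat" where
  "face_number K i = card {J \<in> K. int (card J) - 1 = i}"

text \<open>
  For a complex of dimension \<open>n - 1\<close>, the polynomial
  \<open>h_0 t^n + \<dots> + h_n = (t - 1)^n + f_0 (t - 1)^(n-1) + \<dots> + f_(n-1)\<close>.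
  Its coefficient at \<open>t^(n - i)\<close> is \<open>h_i\<close>; \<open>h_vec n K i\<close> is meant for \<open>i \<le> n\<close> only.
\<close>

definition h_poly :: "nat \<Rightarrow> nat set set \<Rightarrow> int poly" where
  "h_poly n K = (\<Sum>i\<le>n. smult (int (face_number K (int i - 1))) ([:- 1, 1:] ^ (n - i)))"

definition h_vec :: "nat \<Rightarrow> nat set set \<Rightarrow> nat \<Rightarrow> int" where
  "h_vec n K i = coeff (h_poly n K) (n - i)"


subsection \<open>The moment-angle complex and its cells\<close>

text \<open>Points of \<open>\<complex>^m\<close> are the extensional functions on \<open>{1..m}\<close>.\<close>

definition polydisc :: "nat \<Rightarrow> (nat \<Rightarrow> complex) set" where
  "polydisc m = (\<Pi>\<^sub>E i\<in>{1..m}. {w. norm w \<le> 1})"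

definition moment_angle :: "nat \<Rightarrow> nat set set \<Rightarrow> (nat \<Rightarrow> complex) set" where
  "moment_angle m K = (\<Union>J\<in>K. {z \<in> polydisc m. \<forall>j\<in>{1..m} - J. norm (z j) = 1})"

text \<open>A pair \<open>(I, P)\<close> stands for the product cell \<open>D_I T_P\<close>.\<close>

type_synonym cell = "nat set \<times> nat set"

definition cell_points :: "nat \<Rightarrow> cell \<Rightarrow> (nat \<Rightarrow> complex) set" where
  "cell_points m = (\<lambda>(I, P). \<Pi>\<^sub>E i\<in>{1..m}.
     if i \<in> I then {w. norm w < 1} else if i \<in> P then {w. norm w = 1 \<and> w \<noteq> 1} else {1})"

definition cells :: "nat \<Rightarrow> nat set set \<Rightarrow> cell set" where
  "cells m K = {(I, P). I \<subseteq> {1..m} \<and> P \<subseteq> {1..m} \<and> I \<inter> P = {} \<and>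
     cell_points m (I, P) \<subseteq> moment_angle m K}"

definition bideg :: "cell \<Rightarrow> int \<times> int" where
  "bideg = (\<lambda>(I, P). (\<Sum>i\<in>I. (0, 2)) + (\<Sum>i\<in>P. (- 1, 2)))"


subsection \<open>The bigraded cellular chain complex\<close>

text \<open>Chains are functions from cells to the field; those of \<open>Z_K\<close> vanish off \<open>cells m K\<close>.\<close>

definition chain_scale :: "'k::field \<Rightarrow> ('b \<Rightarrow> 'k) \<Rightarrow> ('b \<Rightarrow> 'k)" where
  "chain_scale a c = (\<lambda>e. a * c e)"

interpretation chain: vector_space "chain_scale :: 'k::field \<Rightarrow> ('b \<Rightarrow> 'k) \<Rightarrow> ('b \<Rightarrow> 'k)"
  by unfold_locales (auto simp: chain_scale_def fun_eq_iff algebra_simps)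

definition basis_chain :: "cell \<Rightarrow> cell \<Rightarrow> 'k::field" where
  "basis_chain e = (\<lambda>e'. if e' = e then 1 else 0)"

definition chain_group :: "nat \<Rightarrow> nat set set \<Rightarrow> int \<times> int \<Rightarrow> (cell \<Rightarrow> 'k::field) set" where
  "chain_group m K d = {c. \<forall>e. c e \<noteq> 0 \<longrightarrow> e \<in> cells m K \<and> bideg e = d}"

text \<open>
  In \<open>D^2\<close> the boundary of \<open>D\<close> is \<open>T\<close> and the boundary of \<open>T\<close> is zero. The Leibniz rule
  for product cells gives the sign \<open>(-1)^k\<close> to the \<open>i\<close>-th term, where \<open>k\<close> is the dimension
  of the product of the preceding factors; factors \<open>D\<close> contribute an even dimension.
\<close>

definition cell_boundary :: "cell \<Rightarrow> cell \<Rightarrow> 'k::field" where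
  "cell_boundary = (\<lambda>(I, P).
     \<Sum>i\<in>I. chain_scale ((- 1) ^ card {j \<in> P. j < i}) (basis_chain (I - {i}, insert i P)))"

definition boundary :: "nat \<Rightarrow> nat set set \<Rightarrow> (cell \<Rightarrow> 'k::field) \<Rightarrow> (cell \<Rightarrow> 'k)" where
  "boundary m K c = (\<Sum>e\<in>cells m K. chain_scale (c e) (cell_boundary e))"

definition cycle_group :: "nat \<Rightarrow> nat set set \<Rightarrow> int \<times> int \<Rightarrow> (cell \<Rightarrow> 'k::field) set" where
  "cycle_group m K d = {c \<in> chain_group m K d. boundary m K c = 0}"

text \<open>The differential adds \<open>(-1, 0)\<close> to the bidegree.\<close>

definition boundary_group :: "nat \<Rightarrow> nat set set \<Rightarrow> int \<times> int \<Rightarrow> (cell \<Rightarrow> 'k::field) set" where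
  "boundary_group m K d = boundary m K ` chain_group m K (d + (1, 0))"

text \<open>
  The dimension of the homology (cycles modulo boundaries); see \<open>boundary_group_subset_cycle_group\<close>
  for the inclusion that justifies the subtraction.
\<close>

definition betti :: "'k::field itself \<Rightarrow> nat \<Rightarrow> nat set set \<Rightarrow> int \<times> int \<Rightarrow> nat" where
  "betti _ m K d = chain.dim (cycle_group m K d :: (cell \<Rightarrow> 'k) set)
                 - chain.dim (boundary_group m K d :: (cell \<Rightarrow> 'k) set)"

definition chi :: "'k::field itself \<Rightarrow> nat \<Rightarrow> nat set set \<Rightarrow> nat \<Rightarrow> int" where
  "chi _ m K p = (\<Sum>q\<le>m. (- 1) ^ q *
     int (chain.dim (chain_group m K (- int q, 2 * int p) :: (cell \<Rightarrow> 'k) set)))"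

definition chi_poly :: "'k::field itself \<Rightarrow> nat \<Rightarrow> nat set set \<Rightarrow> int poly" where
  "chi_poly k m K = (\<Sum>p\<le>m. monom (chi k m K p) (2 * p))"


subsection \<open>The cell structure of the moment-angle complex\<close>

lemma cells_eq:
  assumes "simplicial_complex_on m K"
  shows "cells m K = {(I, P). I \<in> K \<and> P \<subseteq> {1..m} \<and> I \<inter> P = {}}"
proof (intro equalityI subsetI; clarify)
  fix I P assume "(I, P) \<in> cells m K"
  then have IP: "I \<subseteq> {1..m}" "P \<subseteq> {1..m}" "I \<inter> P = {}"
    and sub: "cell_points m (I, P) \<subseteq> moment_angle m K" by (auto simp: cells_def)
  define z :: "nat \<Rightarrow> complex" where
    "z = restrict (\<lambda>i. if i \<in> I then 0 else if i \<in> P then - 1 else 1) {1..m}"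
  have "z \<in> cell_points m (I, P)" by (auto simp: z_def cell_points_def)
  with sub have "z \<in> moment_angle m K" by blast
  then obtain J where J: "J \<in> K" "\<forall>j\<in>{1..m} - J. norm (z j) = 1"
    by (auto simp: moment_angle_def)
  have "I \<subseteq> J"
  proof
    fix i assume i: "i \<in> I"
    with IP have "z i = 0" "i \<in> {1..m}" by (auto simp: z_def)
    with J(2) show "i \<in> J" by force
  qed
  with J(1) assms have "I \<in> K" by (auto simp: simplicial_complex_on_def)
  with IP show "I \<in> K \<and> P \<subseteq> {1..m} \<and> I \<inter> P = {}" by blast
next
  fix I P assume IP: "I \<in> K" "P \<subseteq> {1..m}" "I \<inter> P = {}"
  with assms have I: "I \<subseteq> {1..m}" by (auto simp: simplicial_complex_on_def)
  have "cell_points m (I, P) \<subseteq> moment_angle m K"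
  proof
    fix z assume z: "z \<in> cell_points m (I, P)"
    then have *: "z i \<in> (if i \<in> I then {w. norm w < 1} else if i \<in> P then {w. norm w = 1 \<and> w \<noteq> 1} else {1})"
      if "i \<in> {1..m}" for i
      using that unfolding cell_points_def by (auto simp only: prod.case PiE_iff)
    have "norm (z i) \<le> 1" if "i \<in> {1..m}" for i
      using *[OF that] by (auto split: if_splits)
    moreover have "z \<in> extensional {1..m}"
      using z by (auto simp: cell_points_def PiE_iff)
    ultimately have "z \<in> polydisc m" by (auto simp: polydisc_def PiE_iff)
    moreover have "norm (z i) = 1" if "i \<in> {1..m} - I" for i
      using *[of i] that by (auto split: if_splits)
    ultimately show "z \<in> moment_angle m K"
      unfolding moment_angle_def using IP(1) by blast
  qed
  with IP I show "(I, P) \<in> cells m K" by (auto simp: cells_def)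
qed

lemma moment_angle_eq_cells:
  assumes "simplicial_complex_on m K"
  shows "moment_angle m K = (\<Union>e\<in>cells m K. cell_points m e)"
proof
  show "(\<Union>e\<in>cells m K. cell_points m e) \<subseteq> moment_angle m K"
    by (auto simp: cells_def)
  show "moment_angle m K \<subseteq> (\<Union>e\<in>cells m K. cell_points m e)"
  proof
    fix z assume "z \<in> moment_angle m K"
    then obtain J where J: "J \<in> K" "z \<in> polydisc m" "\<forall>j\<in>{1..m} - J. norm (z j) = 1"
      by (auto simp: moment_angle_def)
    define I where "I = {i\<in>{1..m}. norm (z i) < 1}"
    define P where "P = {i\<in>{1..m}. norm (z i) = 1 \<and> z i \<noteq> 1}"
    have "I \<subseteq> J" using J(3) by (force simp: I_def)
    with J(1) assms have "I \<in> K" by (auto simp: simplicial_complex_on_def)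
    then have "(I, P) \<in> cells m K"
      unfolding cells_eq[OF assms] by (auto simp: I_def P_def)
    moreover have "z \<in> cell_points m (I, P)"
      using J(2) by (force simp: cell_points_def polydisc_def PiE_iff I_def P_def)
    ultimately show "z \<in> (\<Union>e\<in>cells m K. cell_points m e)" by blast
  qed
qed

lemma finite_cells: "finite (cells m K)"
  by (rule finite_subset[of _ "Pow {1..m} \<times> Pow {1..m}"]) (auto simp: cells_def)

lemma bideg_eq: "bideg (I, P) = (- int (card P), 2 * int (card I + card P))"
proof -
  have "(\<Sum>i\<in>A. (a, b)) = (int (card A) * a, int (card A) * b)" for A :: "nat set" and a b :: int
    by (induction A rule: infinite_finite_induct) (auto simp: algebra_simps zero_prod_def)
  then show ?thesis by (simp add: bideg_def)
qed


subsection \<open>Chains\<close>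

lemma subspace_chains: "chain.subspace (chain_group m K d)"
  unfolding chain.subspace_def by (force simp: chain_group_def chain_scale_def)

lemma sum_chain_apply: "(\<Sum>x\<in>A. f x) e = (\<Sum>x\<in>A. f x e)" for f :: "'a \<Rightarrow> 'b \<Rightarrow> 'k::field"
  by (induction A rule: infinite_finite_induct) auto

lemma chain_expand:
  assumes "finite A" "\<And>e. c e \<noteq> 0 \<Longrightarrow> e \<in> A"
  shows "c = (\<Sum>e\<in>A. chain_scale (c e) (basis_chain e))"
proof
  fix e
  have "(\<Sum>x\<in>A. chain_scale (c x) (basis_chain x)) e = (\<Sum>x\<in>A. if x = e then c e else 0)"
    unfolding sum_chain_apply by (rule sum.cong) (auto simp: chain_scale_def basis_chain_def)
  also have "\<dots> = c e" using assms(1) assms(2)[of e] by (cases "e \<in> A") auto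
  finally show "c e = (\<Sum>x\<in>A. chain_scale (c x) (basis_chain x)) e" by simp
qed

lemma chains_subset_span:
  "(chain_group m K d :: (cell \<Rightarrow> 'k::field) set) \<subseteq> chain.span (basis_chain ` {e \<in> cells m K. bideg e = d})"
proof
  fix c :: "cell \<Rightarrow> 'k" assume c: "c \<in> chain_group m K d"
  have "c = (\<Sum>e\<in>{e \<in> cells m K. bideg e = d}. chain_scale (c e) (basis_chain e))"
    by (rule chain_expand) (use c finite_cells in \<open>auto simp: chain_group_def\<close>)
  then show "c \<in> chain.span (basis_chain ` {e \<in> cells m K. bideg e = d})"
    by (metis (no_types, lifting) chain.span_base chain.span_scale chain.span_sum imageI)
qed

lemma basis_chain_inj: "(basis_chain e :: cell \<Rightarrow> 'k::field) = basis_chain e' \<longleftrightarrow> e = e'"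
  by (metis basis_chain_def zero_neq_one)

lemma dim_chains:
  "chain.dim (chain_group m K d :: (cell \<Rightarrow> 'k::field) set) = card {e \<in> cells m K. bideg e = d}"
proof -
  define E where "E = {e \<in> cells m K. bideg e = d}"
  let ?B = "basis_chain ` E :: (cell \<Rightarrow> 'k) set"
  have fin: "finite E" using finite_cells by (simp add: E_def)
  have inj: "inj_on (basis_chain :: cell \<Rightarrow> cell \<Rightarrow> 'k) E"
    by (auto simp: inj_on_def basis_chain_inj)
  have "chain.independent ?B"
  proof (rule chain.independent_if_scalars_zero)
    fix f :: "(cell \<Rightarrow> 'k) \<Rightarrow> 'k" and x
    assume 0: "(\<Sum>x\<in>?B. chain_scale (f x) x) = 0" and "x \<in> ?B"
    then obtain e where e: "e \<in> E" "x = basis_chain e" by auto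
    have "(\<Sum>y\<in>E. chain_scale (f (basis_chain y)) (basis_chain y)) = 0"
      using 0 by (simp add: sum.reindex[OF inj])
    then have "(\<Sum>y\<in>E. chain_scale (f (basis_chain y)) (basis_chain y)) e = 0"
      by (simp only: zero_fun_apply)
    also have "(\<Sum>y\<in>E. chain_scale (f (basis_chain y)) (basis_chain y)) e
        = (\<Sum>y\<in>E. if y = e then f x else 0)"
      unfolding sum_chain_apply by (rule sum.cong) (auto simp: chain_scale_def basis_chain_def e)
    finally show "f x = 0" using e fin by simp
  qed (use fin in auto)
  moreover have "?B \<subseteq> chain_group m K d"
    by (auto simp: E_def chain_group_def basis_chain_def split: if_splits)
  ultimately have "chain.dim (chain_group m K d :: (cell \<Rightarrow> 'k) set) = card ?B"
    by (intro chain.basis_card_eq_dim[symmetric]) (simp_all add: E_def chains_subset_span)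
  also have "\<dots> = card E" by (rule card_image[OF inj])
  finally show ?thesis by (simp add: E_def)
qed


subsection \<open>The boundary operator\<close>

lemma linear_boundary:
  "Vector_Spaces.linear chain_scale chain_scale (boundary m K :: (cell \<Rightarrow> 'k::field) \<Rightarrow> (cell \<Rightarrow> 'k))"
  unfolding Vector_Spaces.linear_iff
  by (intro conjI allI chain.vector_space_axioms)
     (auto simp: boundary_def chain_scale_def fun_eq_iff sum_chain_apply sum.distrib
        sum_distrib_left algebra_simps)

lemma cell_boundary_in_chains:
  assumes "simplicial_complex_on m K" "e \<in> cells m K" "bideg e = (a, b)"
  shows "cell_boundary e \<in> chain_group m K (a - 1, b)"
proof -
  obtain I P where e: "e = (I, P)" by force
  have IP: "I \<in> K" "P \<subseteq> {1..m}" "I \<inter> P = {}" using assms cells_eq e by auto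
  have I: "I \<subseteq> {1..m}" using IP assms by (auto simp: simplicial_complex_on_def)
  have fin: "finite I" "finite P" using I IP by (auto intro: finite_subset)
  have "basis_chain (I - {i}, insert i P) \<in> chain_group m K (a - 1, b)" if i: "i \<in> I" for i
  proof -
    have "I - {i} \<in> K" using IP assms by (auto simp: simplicial_complex_on_def)
    then have "(I - {i}, insert i P) \<in> cells m K"
      using IP I i by (auto simp: cells_eq[OF assms(1)])
    moreover have "bideg (I - {i}, insert i P) = (a - 1, b)"
    proof -
      have "i \<notin> P" using i IP by auto
      moreover have "card I = Suc (card (I - {i}))" using fin i by (metis card_Suc_Diff1)
      ultimately show ?thesis using assms(3) fin by (auto simp: e bideg_eq)
    qed
    ultimately show ?thesis by (auto simp: chain_group_def basis_chain_def)
  qed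
  then show ?thesis unfolding e cell_boundary_def prod.case
    by (intro chain.subspace_sum subspace_chains chain.subspace_scale)
qed

lemma boundary_in_chains:
  assumes "simplicial_complex_on m K" "c \<in> chain_group m K (a, b)"
  shows "boundary m K c \<in> chain_group m K (a - 1, b)"
  unfolding boundary_def
proof (rule chain.subspace_sum[OF subspace_chains])
  fix e assume e: "e \<in> cells m K"
  show "chain_scale (c e) (cell_boundary e) \<in> chain_group m K (a - 1, b)"
  proof (cases "c e = 0")
    case True
    then have "chain_scale (c e) (cell_boundary e) = 0" by simp
    then show ?thesis using chain.subspace_0[OF subspace_chains] by metis
  next
    case False
    then have "bideg e = (a, b)" using assms(2) unfolding chain_group_def by blast
    then show ?thesis
      using cell_boundary_in_chains[OF assms(1) e] chain.subspace_scale[OF subspace_chains] by blast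
  qed
qed

lemma boundary_basis_chain:
  assumes "e \<in> cells m K"
  shows "boundary m K (basis_chain e) = (cell_boundary e :: cell \<Rightarrow> 'k::field)"
proof -
  have "boundary m K (basis_chain e) = (\<Sum>x\<in>cells m K. if x = e then cell_boundary e else (0 :: cell \<Rightarrow> 'k))"
    unfolding boundary_def by (rule sum.cong) (auto simp: basis_chain_def chain_scale_def fun_eq_iff)
  with assms finite_cells show ?thesis by simp
qed

lemma boundary_cell_boundary:
  assumes K: "simplicial_complex_on m K" and e: "e \<in> cells m K"
  shows "boundary m K (cell_boundary e) = (0 :: cell \<Rightarrow> 'k::field_char_0)"
proof -
  interpret bd: Vector_Spaces.linear chain_scale chain_scale "boundary m K :: (cell \<Rightarrow> 'k) \<Rightarrow> (cell \<Rightarrow> 'k)"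
    by (rule linear_boundary)
  obtain I P where IPe: "e = (I, P)" by force
  have IP: "I \<in> K" "P \<subseteq> {1..m}" "I \<inter> P = {}" using assms cells_eq IPe by auto
  have I: "I \<subseteq> {1..m}" using IP K by (auto simp: simplicial_complex_on_def)
  have fin: "finite I" "finite P" using I IP by (auto intro: finite_subset)
  define s :: "nat \<Rightarrow> nat set \<Rightarrow> 'k" where "s = (\<lambda>i P. (- 1) ^ card {j \<in> P. j < i})"
  define F :: "nat \<times> nat \<Rightarrow> cell \<Rightarrow> 'k" where
    "F = (\<lambda>(i, k). chain_scale (s i P * s k (insert i P))
            (basis_chain (I - {i} - {k}, insert k (insert i P))))"
  define A where "A = (SIGMA i:I. I - {i})"
  have cell: "(I - {i}, insert i P) \<in> cells m K" if "i \<in> I" for i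
  proof -
    have "I - {i} \<in> K" using IP K by (auto simp: simplicial_complex_on_def)
    then show ?thesis using IP I that by (auto simp: cells_eq[OF K])
  qed
  have "boundary m K (cell_boundary e)
      = (\<Sum>i\<in>I. chain_scale (s i P) (boundary m K (basis_chain (I - {i}, insert i P))))"
    by (simp add: IPe cell_boundary_def bd.sum bd.scale s_def)
  also have "\<dots> = (\<Sum>i\<in>I. chain_scale (s i P) (cell_boundary (I - {i}, insert i P)))"
    by (rule sum.cong) (auto simp: boundary_basis_chain cell)
  also have "\<dots> = (\<Sum>i\<in>I. \<Sum>k\<in>I - {i}. F (i, k))"
    by (simp add: cell_boundary_def chain.scale_sum_right F_def s_def)
  also have "\<dots> = sum F A"
    unfolding A_def using fin by (subst sum.Sigma) auto
  finally have eq: "boundary m K (cell_boundary e) = sum F A" .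
  have anti: "F (k, i) = - F (i, k)" if "(i, k) \<in> A" for i k
  proof -
    have ik: "i \<in> I" "k \<in> I" "i \<noteq> k" "i \<notin> P" "k \<notin> P" using that IP by (auto simp: A_def)
    have s_ins: "s x (insert y P) = (if y < x then - s x P else s x P)" if "y \<notin> P" for x y
    proof -
      have "{j \<in> insert y P. j < x} = (if y < x then insert y {j \<in> P. j < x} else {j \<in> P. j < x})"
        by auto
      then show ?thesis using that fin by (simp add: s_def)
    qed
    have "s k P * s i (insert k P) = - (s i P * s k (insert i P))"
      using ik by (cases "i < k") (auto simp: s_ins)
    moreover have "I - {k} - {i} = I - {i} - {k}" "insert i (insert k P) = insert k (insert i P)"
      by auto
    ultimately show ?thesis by (simp add: F_def)
  qed
  have "sum F A = (\<Sum>(i, k)\<in>A. F (k, i))"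
    by (rule sum.reindex_bij_witness[of _ prod.swap prod.swap]) (auto simp: A_def)
  also have "\<dots> = (\<Sum>x\<in>A. - F x)"
    by (rule sum.cong) (auto simp: anti)
  also have "\<dots> = - sum F A" by (simp add: sum_negf)
  finally have *: "sum F A = - sum F A" .
  have "sum F A = 0"
  proof
    fix x
    have "sum F A x = - sum F A x" using fun_cong[OF *, of x] by simp
    then show "sum F A x = 0 x" by simp
  qed
  with eq show ?thesis by simp
qed

lemma boundary_boundary:
  assumes "simplicial_complex_on m K"
  shows "boundary m K (boundary m K c) = (0 :: cell \<Rightarrow> 'k::field_char_0)"
proof -
  interpret bd: Vector_Spaces.linear chain_scale chain_scale "boundary m K :: (cell \<Rightarrow> 'k) \<Rightarrow> (cell \<Rightarrow> 'k)"
    by (rule linear_boundary)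
  have "boundary m K (boundary m K c)
      = (\<Sum>e\<in>cells m K. chain_scale (c e) (boundary m K (cell_boundary e)))"
    by (simp add: boundary_def[of m K c] bd.sum bd.scale)
  also have "\<dots> = 0" by (rule sum.neutral) (simp add: boundary_cell_boundary[OF assms])
  finally show ?thesis .
qed

lemma boundary_group_subset_cycle_group:
  assumes "simplicial_complex_on m K"
  shows "(boundary_group m K d :: (cell \<Rightarrow> 'k::field_char_0) set) \<subseteq> cycle_group m K d"
proof -
  obtain a b where d: "d = (a, b)" by force
  show ?thesis
    using boundary_in_chains[OF assms, of _ "a + 1" b]
    by (auto simp: d boundary_group_def cycle_group_def boundary_boundary[OF assms])
qed


subsection \<open>The two expressions for the Euler characteristic agree\<close>

lemma rank_nullity_chains:
  fixes f :: "('b \<Rightarrow> 'k::field) \<Rightarrow> ('b \<Rightarrow> 'k)"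
  assumes lin: "Vector_Spaces.linear chain_scale chain_scale f"
    and V: "chain.subspace V" and W: "finite W" "V \<subseteq> chain.span W"
  shows "chain.dim V = chain.dim {x \<in> V. f x = 0} + chain.dim (f ` V)"
proof -
  interpret f: Vector_Spaces.linear chain_scale chain_scale f by (rule lin)
  define Z where "Z = {x \<in> V. f x = 0}"
  obtain A where A: "A \<subseteq> Z" "chain.independent A" "Z \<subseteq> chain.span A"
    using chain.maximal_independent_subset by blast
  obtain B where B: "A \<subseteq> B" "B \<subseteq> V" "chain.independent B" "V \<subseteq> chain.span B"
    using chain.maximal_independent_subset_extend[of A V] A by (auto simp: Z_def)
  have finB: "finite B"
    using chain.independent_span_bound[OF W(1) B(3)] B(2) W(2) by blast
  have spB: "chain.span B = V"
    using B V by (metis chain.span_minimal subset_antisym)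
  have inj: "inj_on f (chain.span (B - A))"
  proof (subst f.inj_on_iff_eq_0)
    show "chain.subspace (chain.span (B - A))" by (rule chain.subspace_span)
    show "\<forall>x\<in>chain.span (B - A). f x = 0 \<longrightarrow> x = 0"
    proof (intro ballI impI)
      fix x assume x: "x \<in> chain.span (B - A)" "f x = 0"
      have xB: "x \<in> chain.span B" using x(1) chain.span_mono[of "B - A" B] by blast
      then have "x \<in> Z" using x spB by (auto simp: Z_def)
      then have xA: "x \<in> chain.span A" using A by blast
      have r1: "chain.representation B x = chain.representation A x"
        by (rule chain.representation_extend) (use B xA in auto)
      have r2: "chain.representation B x = chain.representation (B - A) x"
        by (rule chain.representation_extend) (use B x in auto)
      have "chain.representation B x b = 0" for b
        using chain.representation_ne_zero[of A x b] chain.representation_ne_zero[of "B - A" x b]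
        unfolding r1[symmetric] r2[symmetric] by blast
      then show "x = 0"
        using chain.sum_nonzero_representation_eq[OF B(3) xB] by simp
    qed
  qed
  have ind: "chain.independent (f ` (B - A))"
    by (rule f.independent_injective_image[OF _ inj])
       (use B chain.independent_mono in blast)
  have "f ` V = chain.span (f ` B)" using spB f.span_image by metis
  also have "f ` B \<subseteq> insert 0 (f ` (B - A))" using A(1) by (auto simp: Z_def)
  then have "chain.span (f ` B) \<subseteq> chain.span (f ` (B - A))"
    using chain.span_mono chain.span_insert_0 by metis
  then have "chain.span (f ` B) = chain.span (f ` (B - A))"
    using chain.span_mono[of "f ` (B - A)" "f ` B"] by blast
  finally have "chain.dim (f ` V) = card (f ` (B - A))"
    using ind chain.dim_span_eq_card_independent by metis
  also have "\<dots> = card (B - A)"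
    by (rule card_image) (use inj chain.span_superset inj_on_subset in blast)
  finally have 1: "chain.dim (f ` V) = card (B - A)" .
  have 2: "chain.dim V = card B" using chain.basis_card_eq_dim B by metis
  have 3: "chain.dim Z = card A" using chain.basis_card_eq_dim A by metis
  have "card B = card A + card (B - A)"
    using finB B(1) by (metis card_Diff_subset card_mono finite_subset le_add_diff_inverse)
  with 1 2 3 show ?thesis by (simp add: Z_def)
qed

lemma dim_mono_chains:
  fixes V W :: "('b \<Rightarrow> 'k::field) set"
  assumes "V \<subseteq> W" "finite S" "W \<subseteq> chain.span S"
  shows "chain.dim V \<le> chain.dim W"
proof -
  obtain A where A: "A \<subseteq> V" "chain.independent A" "V \<subseteq> chain.span A"
    using chain.maximal_independent_subset by blast
  obtain B where B: "A \<subseteq> B" "B \<subseteq> W" "chain.independent B" "W \<subseteq> chain.span B"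
    using chain.maximal_independent_subset_extend[of A W] A assms(1) by blast
  have "finite B"
    using chain.independent_span_bound[OF assms(2) B(3)] B(2) assms(3) by blast
  then show ?thesis
    using A B card_mono chain.basis_card_eq_dim by metis
qed

theorem chi_eq_betti:
  assumes K: "simplicial_complex_on m K"
  shows "chi TYPE('k::field_char_0) m K p
       = (\<Sum>q\<le>m. (- 1) ^ q * int (betti TYPE('k) m K (- int q, 2 * int p)))"
proof -
  define D where "D q = chain.dim (chain_group m K (- int q, 2 * int p) :: (cell \<Rightarrow> 'k) set)" for q
  define Z where "Z q = chain.dim (cycle_group m K (- int q, 2 * int p) :: (cell \<Rightarrow> 'k) set)" for q
  define B where "B q = chain.dim (boundary_group m K (- int q, 2 * int p) :: (cell \<Rightarrow> 'k) set)" for q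
  let ?S = "\<lambda>d. basis_chain ` {e \<in> cells m K. bideg e = d} :: (cell \<Rightarrow> 'k) set"
  have finS: "finite (?S d)" for d using finite_cells by auto
  have rank_nullity: "chain.dim (chain_group m K d :: (cell \<Rightarrow> 'k) set)
      = chain.dim (cycle_group m K d :: (cell \<Rightarrow> 'k) set)
        + chain.dim (boundary m K ` chain_group m K d :: (cell \<Rightarrow> 'k) set)" for d
    unfolding cycle_group_def
    by (rule rank_nullity_chains[OF linear_boundary subspace_chains finS chains_subset_span])
  have D: "D q = Z q + B (Suc q)" for q
    using rank_nullity[of "(- int q, 2 * int p)"]
    unfolding D_def Z_def B_def boundary_group_def by simp
  have le: "B q \<le> Z q" for q
    unfolding B_def Z_def
    by (rule dim_mono_chains[OF boundary_group_subset_cycle_group[OF K] finS[of "(- int q, 2 * int p)"]])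
       (unfold cycle_group_def, use chains_subset_span[of m K "(- int q, 2 * int p)"] in blast)
  have no_cells: "{e \<in> cells m K. bideg e = (a, b)} = {}" if "a > 0 \<or> a < - int m" for a b
  proof -
    have False if e: "(I, P) \<in> cells m K" "bideg (I, P) = (a, b)" for I P
    proof -
      have "card P \<le> m"
        using card_mono[of "{1..m}" P] e(1) by (simp add: cells_def)
      with e(2) \<open>a > 0 \<or> a < - int m\<close> show False by (auto simp: bideg_eq)
    qed
    then show ?thesis by force
  qed
  have B0: "B 0 = 0"
  proof -
    have "chain.dim (chain_group m K (1, 2 * int p) :: (cell \<Rightarrow> 'k) set) = 0"
      by (simp add: dim_chains no_cells)
    with rank_nullity[of "(1, 2 * int p)"] show ?thesis
      by (simp add: B_def boundary_group_def)
  qed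
  have Bm: "B (Suc m) = 0"
  proof -
    have "chain.dim (chain_group m K (- int (Suc m), 2 * int p) :: (cell \<Rightarrow> 'k) set) = 0"
      by (simp add: dim_chains no_cells)
    moreover have "B (Suc m) \<le> chain.dim (chain_group m K (- int (Suc m), 2 * int p) :: (cell \<Rightarrow> 'k) set)"
      unfolding B_def
      by (rule dim_mono_chains[OF _ finS chains_subset_span])
         (use boundary_group_subset_cycle_group[OF K] in \<open>auto simp: cycle_group_def\<close>)
    ultimately show ?thesis by simp
  qed
  have tele: "(\<Sum>q\<le>n. (- 1) ^ q * (int (B q) + int (B (Suc q)))) = int (B 0) + (- 1) ^ n * int (B (Suc n))" for n
    by (induction n) (auto simp: algebra_simps)
  have "chi TYPE('k) m K p = (\<Sum>q\<le>m. (- 1) ^ q * int (D q))"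
    by (simp add: chi_def D_def)
  also have "\<dots> = (\<Sum>q\<le>m. (- 1) ^ q * (int (Z q) - int (B q)) + (- 1) ^ q * (int (B q) + int (B (Suc q))))"
    by (rule sum.cong) (auto simp: D algebra_simps)
  also have "\<dots> = (\<Sum>q\<le>m. (- 1) ^ q * (int (Z q) - int (B q)))"
    by (simp add: sum.distrib tele B0 Bm)
  also have "\<dots> = (\<Sum>q\<le>m. (- 1) ^ q * int (betti TYPE('k) m K (- int q, 2 * int p)))"
    using le by (intro sum.cong) (auto simp: betti_def Z_def[symmetric] B_def[symmetric] of_nat_diff)
  finally show ?thesis .
qed

end

theory Submission
  imports Defs
begin

text \<open>
  Chain groups have the cells as bases, so the Euler characteristic is a signed count of cells:
  writing \<open>x = t\<^sup>2\<close>, the cell \<open>D_I T_P\<close> contributes \<open>(- 1)^|P| x^(|I| + |P|)\<close>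
  (\<open>chi_poly_eq_sum_cells\<close>). For a fixed face \<open>I\<close> the set \<open>P\<close> runs over all subsets of
  \<open>[m] - I\<close>, so the coordinates outside \<open>I\<close> vary independently, each choosing between the
  cell \<open>1\<close> of weight \<open>1\<close> and the cell \<open>T\<close> of weight \<open>- x\<close>. Hence the total is the sum of
  \<open>x^|I| (1 - x)^(m - |I|)\<close> over the faces \<open>I\<close> (\<open>sum_cells_eq_sum_faces\<close>).

  No face has more than \<open>n \<le> m\<close> vertices, so \<open>(1 - x)^(m - n)\<close> splits off, and grouping the
  faces by size leaves the sum of \<open>f_(j-1) x^j (1 - x)^(n - j)\<close> over \<open>j \<le> n\<close>. This is
  \<open>x^n H(1 / x)\<close> for the polynomial \<open>H(t) = h_0 t^n + \<dots> + h_n\<close>, whose definition expands it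
  in powers of \<open>t - 1\<close>; so it is \<open>h_0 + h_1 x + \<dots> + h_n x^n\<close>
  (\<open>h_vec_generating_function\<close>).
\<close>

lemma sum_powers_over_subsets:
  fixes y :: "'a::comm_semiring_1"
  assumes "finite A"
  shows "(\<Sum>P\<in>Pow A. y ^ card P) = (1 + y) ^ card A"
  using prod_add[OF assms, of "\<lambda>_. y" "\<lambda>_. 1"] by (simp add: add.commute)

text \<open>
  This is \<open>x^n p(1 / x)\<close> for \<open>p = (t - 1)^k\<close>, written through the reversed coefficient list
  so that it makes sense in a ring where \<open>x\<close> has no inverse, such as the polynomial ring.
  In the induction, multiplying by \<open>t\<close> lowers the reversal length by one and multiplying
  by \<open>- 1\<close> keeps it, so the induction hypothesis is needed at two different lengths.
\<close>

lemma reversed_power_eval: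
  fixes x :: "'a::comm_ring_1"
  assumes "k \<le> n"
  shows "(\<Sum>i\<le>n. of_int (coeff ([:- 1, 1:] ^ k) (n - i)) * x ^ i) = x ^ (n - k) * (1 - x) ^ k"
  using assms
proof (induction k arbitrary: n)
  case 0
  have "(\<Sum>i\<le>n. of_int (coeff ([:- 1, 1:] ^ 0) (n - i)) * x ^ i) = (\<Sum>i\<le>n. if i = n then x ^ i else 0)"
    by (rule sum.cong) auto
  then show ?case by simp
next
  case (Suc k)
  then obtain n' where n: "n = Suc n'" "k \<le> n'" by (cases n) auto
  define q :: "int poly" where "q = [:- 1, 1:] ^ k"
  have step: "coeff ([:- 1, 1:] ^ Suc k) (Suc j) = coeff q j - coeff q (Suc j)" for j
    by (simp add: q_def)
  have last: "coeff ([:- 1, 1:] ^ Suc k) 0 = - coeff q 0"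
    by (simp add: q_def)
  have "(\<Sum>i\<le>n. of_int (coeff ([:- 1, 1:] ^ Suc k) (n - i)) * x ^ i)
      = (\<Sum>i\<le>n'. of_int (coeff q (n' - i)) * x ^ i) - (\<Sum>i\<le>n. of_int (coeff q (n - i)) * x ^ i)"
    by (simp del: power_Suc add: n last Suc_diff_le step sum_subtractf algebra_simps)
  also have "\<dots> = x ^ (n' - k) * (1 - x) ^ k - x ^ (Suc n' - k) * (1 - x) ^ k"
    using Suc.IH[of n'] Suc.IH[of n] n by (simp add: q_def)
  also have "\<dots> = x ^ (n - Suc k) * (1 - x) ^ Suc k"
    using n by (simp add: Suc_diff_le algebra_simps)
  finally show ?case .
qed

lemma monom_eq_of_int_mult_power: "monom (a :: int) (2 * i) = of_int a * monom 1 2 ^ i"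
  by (simp add: monom_power of_int_poly smult_monom mult.commute)

text \<open>
  Reversing coefficients is linear in the polynomial, so it acts separately on the terms
  \<open>f_(j-1) (t - 1)^(n - j)\<close> that define the \<open>h\<close>-vector.
\<close>

lemma h_vec_generating_function:
  fixes x :: "'a::comm_ring_1"
  shows "(\<Sum>i\<le>n. of_int (h_vec n K i) * x ^ i)
       = (\<Sum>j\<le>n. of_nat (face_number K (int j - 1)) * x ^ j * (1 - x) ^ (n - j))"
proof -
  let ?f = "\<lambda>j. face_number K (int j - 1)"
  have "(\<Sum>i\<le>n. of_int (h_vec n K i) * x ^ i)
      = (\<Sum>i\<le>n. \<Sum>j\<le>n. of_nat (?f j) * (of_int (coeff ([:- 1, 1:] ^ (n - j)) (n - i)) * x ^ i))"
    by (simp add: h_vec_def h_poly_def coeff_sum sum_distrib_right mult.assoc)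
  also have "\<dots> = (\<Sum>j\<le>n. of_nat (?f j) * (\<Sum>i\<le>n. of_int (coeff ([:- 1, 1:] ^ (n - j)) (n - i)) * x ^ i))"
    by (subst sum.swap) (simp add: sum_distrib_left)
  also have "\<dots> = (\<Sum>j\<le>n. of_nat (?f j) * x ^ j * (1 - x) ^ (n - j))"
    by (rule sum.cong) (simp_all add: reversed_power_eval mult.assoc)
  finally show ?thesis .
qed

lemma sum_by_card_eq_face_numbers:
  fixes g :: "nat \<Rightarrow> 'a::comm_ring_1"
  assumes "finite K" "\<And>I. I \<in> K \<Longrightarrow> card I \<le> n"
  shows "(\<Sum>I\<in>K. g (card I)) = (\<Sum>j\<le>n. of_nat (face_number K (int j - 1)) * g j)"
proof -
  have "(\<Sum>I\<in>K. g (card I)) = (\<Sum>j\<le>n. \<Sum>I\<in>{I \<in> K. card I = j}. g (card I))"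
    by (rule sum.group[symmetric]) (use assms in auto)
  also have "\<dots> = (\<Sum>j\<le>n. of_nat (face_number K (int j - 1)) * g j)"
    by (rule sum.cong) (simp_all add: face_number_def)
  finally show ?thesis .
qed

text \<open>
  A cell is counted in \<open>chi\<close> exactly once, at \<open>p = |I| + |P|\<close> and \<open>q = |P|\<close>. Both indices are
  at most \<open>m\<close> because \<open>I\<close> and \<open>P\<close> are disjoint, so the truncation of the sums at \<open>m\<close> loses
  no cell.
\<close>

lemma chi_poly_eq_sum_cells:
  "chi_poly TYPE('k::field) m K
     = (\<Sum>(I, P)\<in>cells m K. (- 1) ^ card P * monom 1 2 ^ (card I + card P))"
proof -
  define w :: "cell \<Rightarrow> int poly" where
    "w = (\<lambda>(I, P). (- 1) ^ card P * monom 1 2 ^ (card I + card P))"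
  define g :: "cell \<Rightarrow> nat \<times> nat" where "g = (\<lambda>(I, P). (card I + card P, card P))"
  have dim: "chain.dim (chain_group m K (- int q, 2 * int p) :: (cell \<Rightarrow> 'k) set)
      = card {e \<in> cells m K. g e = (p, q)}" for p q
    unfolding dim_chains by (rule arg_cong[of _ _ card]) (auto simp: bideg_eq g_def)
  have range: "g ` cells m K \<subseteq> {..m} \<times> {..m}"
  proof -
    have "card I + card P \<le> m" if "(I, P) \<in> cells m K" for I P
    proof -
      have IP: "I \<subseteq> {1..m}" "P \<subseteq> {1..m}" "I \<inter> P = {}" using that by (auto simp: cells_def)
      then have "card I + card P = card (I \<union> P)"
        by (metis card_Un_disjoint finite_atLeastAtMost finite_subset)
      also have "\<dots> \<le> card {1..m}" using IP by (intro card_mono) auto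
      finally show ?thesis by simp
    qed
    then show ?thesis by (fastforce simp: g_def)
  qed
  have "chi_poly TYPE('k) m K = (\<Sum>p\<le>m. of_int (chi TYPE('k) m K p) * monom 1 2 ^ p)"
    unfolding chi_poly_def monom_eq_of_int_mult_power ..
  also have "\<dots> = (\<Sum>p\<le>m. (\<Sum>q\<le>m. (- 1) ^ q * of_nat (card {e \<in> cells m K. g e = (p, q)})) * monom 1 2 ^ p)"
    by (simp add: chi_def dim)
  also have "\<dots> = (\<Sum>(p, q)\<in>{..m} \<times> {..m}. of_nat (card {e \<in> cells m K. g e = (p, q)}) * ((- 1) ^ q * monom 1 2 ^ p))"
    by (simp add: sum_distrib_left sum.cartesian_product[symmetric] ac_simps)
  also have "\<dots> = (\<Sum>pq\<in>{..m} \<times> {..m}. \<Sum>e\<in>{e \<in> cells m K. g e = pq}. w e)"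
  proof (rule sum.cong, rule refl, clarify)
    fix p q
    have "(\<Sum>e\<in>{e \<in> cells m K. g e = (p, q)}. w e)
        = (\<Sum>e\<in>{e \<in> cells m K. g e = (p, q)}. (- 1) ^ q * monom 1 2 ^ p)"
      by (rule sum.cong) (auto simp: g_def w_def)
    then show "of_nat (card {e \<in> cells m K. g e = (p, q)}) * ((- 1) ^ q * monom 1 2 ^ p)
        = (\<Sum>e\<in>{e \<in> cells m K. g e = (p, q)}. w e)" by simp
  qed
  also have "\<dots> = (\<Sum>e\<in>cells m K. w e)"
    by (rule sum.group) (use finite_cells range in auto)
  finally show ?thesis by (simp add: w_def)
qed

lemma sum_cells_eq_sum_faces:
  fixes x :: "'a::comm_ring_1"
  assumes K: "simplicial_complex_on m K"
  shows "(\<Sum>(I, P)\<in>cells m K. (- 1) ^ card P * x ^ (card I + card P))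
       = (\<Sum>I\<in>K. x ^ card I * (1 - x) ^ (m - card I))"
proof -
  have sub: "K \<subseteq> Pow {1..m}" using K by (simp add: simplicial_complex_on_def)
  have finK: "finite K" using sub by (rule finite_subset) simp
  have cells: "cells m K = (SIGMA I:K. Pow ({1..m} - I))"
    unfolding cells_eq[OF K] by auto
  have "(\<Sum>(I, P)\<in>cells m K. (- 1) ^ card P * x ^ (card I + card P))
      = (\<Sum>I\<in>K. \<Sum>P\<in>Pow ({1..m} - I). x ^ card I * (- x) ^ card P)"
    unfolding cells using finK
    by (subst sum.Sigma) (auto simp: power_add power_minus[of x] mult_ac intro!: sum.cong)
  also have "\<dots> = (\<Sum>I\<in>K. x ^ card I * (1 - x) ^ (m - card I))"
  proof (rule sum.cong)
    fix I assume "I \<in> K"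
    then have "card ({1..m} - I) = m - card I"
      using sub by (subst card_Diff_subset) (auto intro: finite_subset)
    then show "(\<Sum>P\<in>Pow ({1..m} - I). x ^ card I * (- x) ^ card P) = x ^ card I * (1 - x) ^ (m - card I)"
      by (simp add: sum_distrib_left[symmetric] sum_powers_over_subsets)
  qed simp
  finally show ?thesis .
qed

lemma face_cards_of_complex_dim:
  assumes K: "simplicial_complex_on m K" and dim: "complex_dim K = int n - 1"
  shows "n \<le> m" "I \<in> K \<Longrightarrow> card I \<le> n"
proof -
  have sub: "K \<subseteq> Pow {1..m}" and ne: "K \<noteq> {}"
    using K by (auto simp: simplicial_complex_on_def)
  have finK: "finite K" using sub by (rule finite_subset) simp
  have "complex_dim K \<in> (\<lambda>J. int (card J) - 1) ` K"
    unfolding complex_dim_def by (rule Max_in) (use finK ne in auto)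
  then obtain J where "J \<in> K" "card J = n" using dim by auto
  then show "n \<le> m" using sub card_mono[of "{1..m}" J] by auto
  show "card I \<le> n" if "I \<in> K"
  proof -
    have "int (card I) - 1 \<le> complex_dim K"
      unfolding complex_dim_def by (rule Max_ge) (use finK that in auto)
    then show ?thesis using dim by simp
  qed
qed

theorem theorem4p7:
  fixes m n :: nat and K :: "nat set set"
  assumes "simplicial_complex_on m K"
    and "complex_dim K = int n - 1"
    and "K \<noteq> Pow {1..m}"
  shows "chi_poly TYPE('k::field_char_0) m K
       = (1 - monom 1 2) ^ (m - n) * (\<Sum>i\<le>n. monom (h_vec n K i) (2 * i))"
proof -
  let ?x = "monom 1 2 :: int poly"
  let ?f = "\<lambda>j. of_nat (face_number K (int j - 1)) :: int poly"
  note bounds = face_cards_of_complex_dim[OF assms(1,2)]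
  have finK: "finite K"
    using assms(1) by (auto simp: simplicial_complex_on_def intro: finite_subset)
  have "chi_poly TYPE('k) m K = (\<Sum>I\<in>K. ?x ^ card I * (1 - ?x) ^ (m - card I))"
    by (simp only: chi_poly_eq_sum_cells sum_cells_eq_sum_faces[OF assms(1)])
  also have "\<dots> = (\<Sum>j\<le>n. ?f j * (?x ^ j * (1 - ?x) ^ (m - j)))"
    using finK bounds(2) by (rule sum_by_card_eq_face_numbers)
  also have "\<dots> = (\<Sum>j\<le>n. (1 - ?x) ^ (m - n) * (?f j * ?x ^ j * (1 - ?x) ^ (n - j)))"
  proof (rule sum.cong)
    fix j assume "j \<in> {..n}"
    then have "m - j = (m - n) + (n - j)" using bounds(1) by simp
    then show "?f j * (?x ^ j * (1 - ?x) ^ (m - j))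
        = (1 - ?x) ^ (m - n) * (?f j * ?x ^ j * (1 - ?x) ^ (n - j))"
      by (simp only: power_add mult_ac)
  qed simp
  also have "\<dots> = (1 - ?x) ^ (m - n) * (\<Sum>i\<le>n. of_int (h_vec n K i) * ?x ^ i)"
    by (simp only: h_vec_generating_function sum_distrib_left)
  finally show ?thesis by (simp only: monom_eq_of_int_mult_power)
qed

end
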